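(* Let $r$ be a positive integer, let $w=w_1\cdots w_n$ be a primitive word on the alphabet $A=\{1<2<\cdots<r\}$ such that every letter of $A$ occurs in $w$, and let $\pi\neq \mathrm{Id}$ be a permutation of $\{1,\ldots,r\}$. The following are equivalent: (1) $w$ is $\pi$-clustering; (2) $ww$ occurs in a trajectory of a minimal discrete $r$-interval exchange transformation with permutation $\pi$; (3) $ww$ occurs in a trajectory of a discrete $r$-interval exchange transformation with permutation $\pi$; (4) $ww$ occurs in a trajectory of a continuous $r$-interval exchange transformation with permutation $\pi$.
   Context: A word is primitive if it is not a power $u^k$, $k\ge 2$, of another word $u$. The conjugates of $w=w_1\cdots w_n$ are the words $w_i\cdots w_nw_1\cdots w_{i-1}$, $1\le i\le n$; if $w$ is primitive they are $n$ distinct words. The Burrows-Wheeler transform $B(w)$ of a primitive word $w$ is obtained by listing the $n$ conjugates of $w$ in ascending lexicographical order, $w_{i,1}w_{i,2}\cdots w_{i,n}$ being the $i$-th one, and setting $B(w)=w_{1,n}w_{2,n}\cdots w_{n,n}$ (the word of last letters). Let $n_i$ be the number of occurrences of the letter $i$ in $w$. For a permutation $\pi\ne\mathrm{Id}$ of $\{1,\ldots,r\}$, the word $w$ is $\pi$-clustering if $B(w)=(\pi 1)^{n_{\pi 1}}(\pi 2)^{n_{\pi 2}}\cdots(\pi r)^{n_{\pi r}}$. A continuous $r$-interval exchange transformation $T$ with probability vector $(\alpha_1,\ldots,\alpha_r)$ and permutation $\pi$ is the map on $[0,1[$, partitioned into the intervals $\Delta_i=\left[\sum_{j<i}\alpha_j,\sum_{j\le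 i}\alpha_j\right[$, defined by $Tx=x+\tau_i$ for $x\in\Delta_i$, where $\tau_i=\sum_{\pi^{-1}(j)<\pi^{-1}(i)}\alpha_j-\sum_{j<i}\alpha_j$. (The word "continuous" does not mean that $T$ is a continuous map.) A discrete $r$-interval exchange transformation $T$ with length vector $(n_1,\ldots,n_r)$ (integers) and permutation $\pi$ is the map on a set of $n_1+\cdots+n_r$ points $x_1,\ldots,x_{n_1+\cdots+n_r}$, partitioned into $\Delta_i=\{x_k:\ \sum_{j<i}n_j<k\le\sum_{j\le i}n_j\}$, defined by $Tx_k=x_{k+s_i}$ for $x_k\in\Delta_i$, where $s_i=\sum_{\pi^{-1}(j)<\pi^{-1}(i)}n_j-\sum_{j<i}n_j$. In (2), (3) and (4) the length vector or probability vector is not prescribed. The trajectory of a point $x$ under $T$ is the infinite sequence $(y_m)_{m\ge 0}$ with $y_m=i$ if $T^mx\in\Delta_i$. A word occurs in a trajectory if it is a block of consecutive terms of it. A transformation $T$ on $X$ is minimal if whenever $E$ is a nonempty closed subset of $X$ with $T^{-1}E=E$, then $E=X$; a finite set carries the discrete topology. *)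

theory Defs
  imports
    "HOL-Analysis.Analysis"
    "HOL-Combinatorics.Permutations"
    "HOL-Library.List_Lexorder"
begin

(* Words are lists over nat; the alphabet {1 < ... < r} is {1..r}.
   The order on lists is the lexicographic one of List_Lexorder. *)

definition primitive_word :: "'a list \<Rightarrow> bool" where
  "primitive_word w \<longleftrightarrow> \<not> (\<exists>u k. 2 \<le> k \<and> w = concat (replicate k u))"

(* rotate i w = w_{i+1} ... w_n w_1 ... w_i for i < n *)
definition conjugates :: "'a list \<Rightarrow> 'a list list" where
  "conjugates w = map (\<lambda>i. rotate i w) [0..<length w]"

definition burrows_wheeler :: "'a::linorder list \<Rightarrow> 'a list" where
  "burrows_wheeler w = map last (sort (conjugates w))"

definition clustering :: "nat \<Rightarrow> (nat \<Rightarrow> nat) \<Rightarrow> nat list \<Rightarrow> bool" where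
  "clustering r \<pi> w \<longleftrightarrow>
     burrows_wheeler w = concat (map (\<lambda>i. replicate (count_list w (\<pi> i)) (\<pi> i)) [1..<Suc r])"

(* The discrete and the continuous case share the formula for the translation lengths and
   for the map: a is the vector of lengths (integer or real) and D the family of intervals
   partitioning the space. The values of iet_map outside the union of the D i (1 <= i <= r)
   are irrelevant. *)

definition iet_shift :: "nat \<Rightarrow> (nat \<Rightarrow> nat) \<Rightarrow> (nat \<Rightarrow> 'a::ab_group_add) \<Rightarrow> nat \<Rightarrow> 'a" where
  "iet_shift r \<pi> a i =
     (\<Sum>j\<in>{j\<in>{1..r}. inv \<pi> j < inv \<pi> i}. a j) - (\<Sum>j\<in>{1..<i}. a j)"

definition iet_map ::
  "nat \<Rightarrow> (nat \<Rightarrow> nat) \<Rightarrow> (nat \<Rightarrow> 'a::ab_group_add) \<Rightarrow> (nat \<Rightarrow> 'a set) \<Rightarrow> 'a \<Rightarrow> 'a" where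
  "iet_map r \<pi> a D x = x + iet_shift r \<pi> a (THE i. i \<in> {1..r} \<and> x \<in> D i)"

definition is_trajectory ::
  "nat \<Rightarrow> (nat \<Rightarrow> 'a set) \<Rightarrow> ('a \<Rightarrow> 'a) \<Rightarrow> 'a \<Rightarrow> (nat \<Rightarrow> nat) \<Rightarrow> bool" where
  "is_trajectory r D T x y \<longleftrightarrow> (\<forall>m. y m \<in> {1..r} \<and> (T ^^ m) x \<in> D (y m))"

definition occurs_in :: "'a list \<Rightarrow> (nat \<Rightarrow> 'a) \<Rightarrow> bool" where
  "occurs_in v y \<longleftrightarrow> (\<exists>p. v = map y [p..<p + length v])"

definition minimal_map :: "'a topology \<Rightarrow> ('a \<Rightarrow> 'a) \<Rightarrow> bool" where
  "minimal_map X T \<longleftrightarrow>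
     (\<forall>E. closedin X E \<and> E \<noteq> {} \<and> {x \<in> topspace X. T x \<in> E} = E \<longrightarrow> E = topspace X)"

(* Discrete case: the point x_k is represented by its index k, an integer. *)

definition length_vector :: "nat \<Rightarrow> (nat \<Rightarrow> int) \<Rightarrow> bool" where
  "length_vector r l \<longleftrightarrow> (\<forall>i\<in>{1..r}. 0 \<le> l i)"

definition discrete_space :: "nat \<Rightarrow> (nat \<Rightarrow> int) \<Rightarrow> int set" where
  "discrete_space r l = {1..\<Sum>j\<in>{1..r}. l j}"

definition discrete_interval :: "(nat \<Rightarrow> int) \<Rightarrow> nat \<Rightarrow> int set" where
  "discrete_interval l i = {(\<Sum>j\<in>{1..<i}. l j) <.. (\<Sum>j\<in>{1..i}. l j)}"

definition discrete_iet :: "nat \<Rightarrow> (nat \<Rightarrow> nat) \<Rightarrow> (nat \<Rightarrow> int) \<Rightarrow> int \<Rightarrow> int" where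
  "discrete_iet r \<pi> l = iet_map r \<pi> l (discrete_interval l)"

definition occurs_in_discrete_iet ::
  "nat \<Rightarrow> (nat \<Rightarrow> nat) \<Rightarrow> (nat \<Rightarrow> int) \<Rightarrow> nat list \<Rightarrow> bool" where
  "occurs_in_discrete_iet r \<pi> l v \<longleftrightarrow>
     (\<exists>x\<in>discrete_space r l. \<exists>y.
        is_trajectory r (discrete_interval l) (discrete_iet r \<pi> l) x y \<and> occurs_in v y)"

definition probability_vector :: "nat \<Rightarrow> (nat \<Rightarrow> real) \<Rightarrow> bool" where
  "probability_vector r \<alpha> \<longleftrightarrow> (\<forall>i\<in>{1..r}. 0 \<le> \<alpha> i) \<and> (\<Sum>i\<in>{1..r}. \<alpha> i) = 1"

definition continuous_interval :: "(nat \<Rightarrow> real) \<Rightarrow> nat \<Rightarrow> real set" where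
  "continuous_interval \<alpha> i = {(\<Sum>j\<in>{1..<i}. \<alpha> j) ..< (\<Sum>j\<in>{1..i}. \<alpha> j)}"

definition continuous_iet :: "nat \<Rightarrow> (nat \<Rightarrow> nat) \<Rightarrow> (nat \<Rightarrow> real) \<Rightarrow> real \<Rightarrow> real" where
  "continuous_iet r \<pi> \<alpha> = iet_map r \<pi> \<alpha> (continuous_interval \<alpha>)"

definition occurs_in_continuous_iet ::
  "nat \<Rightarrow> (nat \<Rightarrow> nat) \<Rightarrow> (nat \<Rightarrow> real) \<Rightarrow> nat list \<Rightarrow> bool" where
  "occurs_in_continuous_iet r \<pi> \<alpha> v \<longleftrightarrow>
     (\<exists>x\<in>{0..<1}. \<exists>y.
        is_trajectory r (continuous_interval \<alpha>) (continuous_iet r \<pi> \<alpha>) x y \<and> occurs_in v y)"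

end

theory Submission
  imports Defs
begin

text \<open>
  Clustering is a monotonicity property. The Burrows-Wheeler transform lists the last letters of
  the conjugates in lexicographic order, and the word it is compared with is the rearrangement of
  the letters of \<open>w\<close> that is sorted with respect to \<open>inv \<pi>\<close>. Hence \<open>w\<close> is clustering iff
  \<open>c < d\<close> implies \<open>inv \<pi> (last c) \<le> inv \<pi> (last d)\<close> for conjugates \<open>c\<close>, \<open>d\<close>
  (\<open>clustering_iff_mono_last\<close>). An interval exchange has the same property: it
  is increasing on each interval, and it arranges the images of the intervals in the order given
  by \<open>inv \<pi>\<close>.

  For a square \<open>ww\<close> in a trajectory, every conjugate of \<open>w\<close> is read off at some point of the orbit
  which has a predecessor on the window occupied by \<open>ww\<close>; the predecessor lies in
  the interval named by the last letter of the conjugate. Points are ordered in the same way as their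
  itineraries, so the order of the images of the intervals gives the monotonicity of the last
  letters (\<open>continuous_occurrence_imp_clustering\<close>). A discrete exchange rescales to a
  continuous one with the same trajectories (\<open>discrete_occurrence_imp_continuous\<close>),
  which settles the discrete case as well.

  For the converse, let the conjugates themselves be the points, in lexicographic order, with the letter
  counts of \<open>w\<close> as lengths. The \<open>i\<close>-th interval consists of the conjugates starting with \<open>i\<close>.
  Moving the first letter to the end preserves the order of these conjugates and, if \<open>w\<close> is clustering,
  sends them onto the block of conjugates ending with \<open>i\<close>, which sits where \<open>\<pi>\<close> prescribes.
  The discrete exchange is therefore \<open>rotate1\<close>
  (\<open>discrete_iet_conjugate_point\<close>). This is one cycle, hence minimal, and its trajectory
  from \<open>w\<close> is the periodic word \<open>www...\<close>.
\<close>

section \<open>Conjugates and the lexicographic order\<close>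

lemma set_conjugates: "set (conjugates w) = (\<lambda>i. rotate i w) ` {..<length w}"
  by (auto simp: conjugates_def)

lemma length_conjugate: "c \<in> set (conjugates w) \<Longrightarrow> length c = length w"
  by (auto simp: set_conjugates)

lemma set_conjugate: "c \<in> set (conjugates w) \<Longrightarrow> set c = set w"
  by (auto simp: set_conjugates)

lemma rotate_in_conjugates:
  assumes "w \<noteq> []" shows "rotate m w \<in> set (conjugates w)"
proof -
  have "rotate m w = rotate (m mod length w) w" by (rule rotate_conv_mod)
  then show ?thesis using assms by (auto simp: set_conjugates)
qed

text \<open>
  With exponents in \<open>{1..length w}\<close> instead of \<open>{0..<length w}\<close>, a conjugate is read off \<open>ww\<close>
  at a position that has a predecessor inside \<open>ww\<close>; that predecessor carries its last letter.
\<close>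

lemma conjugate_as_positive_rotation:
  assumes "c \<in> set (conjugates w)"
  obtains s where "1 \<le> s" "s \<le> length w" "c = rotate s w"
proof -
  obtain i where i: "i < length w" "c = rotate i w" using assms by (auto simp: set_conjugates)
  show ?thesis
  proof (cases "i = 0")
    case True
    have "1 \<le> length w" using i(1) by linarith
    moreover have "c = rotate (length w) w" using i(2) True by (simp add: rotate_id)
    ultimately show ?thesis using that[of "length w"] by blast
  next
    case False
    then show ?thesis using i that[of i] by simp
  qed
qed

lemma last_rotate:
  assumes "w \<noteq> []" shows "last (rotate i w) = w ! ((i + (length w - 1)) mod length w)"
proof -
  have "last (rotate i w) = rotate i w ! (length w - 1)"
    using assms by (simp add: last_conv_nth)
  also have "\<dots> = w ! ((i + (length w - 1)) mod length w)"
    using assms by (simp add: nth_rotate)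
  finally show ?thesis .
qed

lemma last_rotate1: "c \<noteq> [] \<Longrightarrow> last (rotate1 c) = hd c"
  by (cases c) auto

lemma map_last_conjugates: "map last (conjugates w) = rotate (length w - 1) w"
proof (rule nth_equalityI)
  show "length (map last (conjugates w)) = length (rotate (length w - 1) w)"
    by (simp add: conjugates_def)
next
  fix i assume "i < length (map last (conjugates w))"
  then have i: "i < length w" by (simp add: conjugates_def)
  then have "w \<noteq> []" by auto
  with i show "map last (conjugates w) ! i = rotate (length w - 1) w ! i"
    by (simp add: conjugates_def last_rotate nth_rotate add.commute)
qed

text \<open>
  A nontrivial rotation fixing \<open>w\<close> means that \<open>w\<close> is a product of two commuting nonempty words;
  these are powers of a common word.
\<close>

lemma rotate_eq_self_imp_not_primitive:
  assumes "rotate k w = w" "0 < k" "k < length w"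
  shows "\<not> primitive_word w"
proof -
  let ?x = "take k w" and ?y = "drop k w"
  have "?x @ ?y = ?y @ ?x"
    using assms by (metis append_take_drop_id mod_less rotate_drop_take)
  then obtain m n z where z: "concat (replicate m z) = ?x" "concat (replicate n z) = ?y"
    using comm_append_are_replicate by blast
  have "m \<noteq> 0" "n \<noteq> 0" using z assms by (auto intro!: Nat.gr0I)
  then have "2 \<le> m + n" by simp
  moreover have "w = concat (replicate (m + n) z)"
    using z by (simp add: replicate_add)
  ultimately show ?thesis unfolding primitive_word_def by blast
qed

lemma inj_on_rotate_primitive:
  assumes "primitive_word w"
  shows "inj_on (\<lambda>i. rotate i w) {..<length w}"
proof -
  have False if "i < j" "j < length w" "rotate i w = rotate j w" for i j
  proof -
    let ?n = "length w"
    have "rotate (?n - i) (rotate i w) = rotate ?n w"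
      using that(1,2) by (simp add: rotate_rotate)
    then have "rotate (?n - i) (rotate i w) = w" by simp
    moreover have "rotate (?n - i) (rotate j w) = rotate (j - i) w"
    proof -
      have "?n - i + j = j - i + ?n" using that by simp
      then have "rotate (?n - i) (rotate j w) = rotate (j - i) (rotate ?n w)"
        by (simp only: rotate_rotate)
      also have "rotate ?n w = w" by (simp add: rotate_id)
      finally show ?thesis .
    qed
    ultimately have "rotate (j - i) w = w" using that by simp
    moreover have "0 < j - i" "j - i < ?n" using that(1,2) by linarith+
    ultimately show False using rotate_eq_self_imp_not_primitive assms by blast
  qed
  then show ?thesis
    by (intro inj_onI) (metis lessThan_iff linorder_neqE_nat)
qed

lemma less_same_length_iff:
  fixes c d :: "'a::linorder list"
  assumes "length c = length d"
  shows "c < d \<longleftrightarrow> (\<exists>k<length c. (\<forall>t<k. c ! t = d ! t) \<and> c ! k < d ! k)"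
proof -
  have "take k c = take k d \<longleftrightarrow> (\<forall>t<k. c ! t = d ! t)" if "k < length c" for k
    using that assms nth_take_lemma[of k c d] by (auto dest: nth_take_lemma) (metis nth_take)
  then show ?thesis
    using assms by (auto simp: list_less_def lexord_take_index_conv)
qed

lemma rotate1_less:
  fixes c d :: "'a::linorder list"
  assumes "length c = length d" "c \<noteq> []" "hd c = hd d" "c < d"
  shows "rotate1 c < rotate1 d"
proof -
  obtain a u where c: "c = a # u" using assms by (cases c) auto
  obtain v where d: "d = a # v" using assms c by (cases d) auto
  have "(u, v) \<in> lexord {(x, y). x < y}"
    using assms c d by (simp add: list_less_def)
  then show ?thesis
    using lexord_sufI[of u v _ "[a]" "[a]"] assms c d by (simp add: list_less_def)
qed

section \<open>Clustering as monotonicity of last letters\<close>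

lemma sorted_map_iff_mono:
  fixes xs :: "'a::linorder list" and f :: "'a \<Rightarrow> 'b::linorder"
  assumes "sorted xs"
  shows "sorted (map f xs) \<longleftrightarrow> (\<forall>x\<in>set xs. \<forall>y\<in>set xs. x < y \<longrightarrow> f x \<le> f y)"
  using assms
proof (induction xs)
  case Nil
  then show ?case by simp
next
  case (Cons a xs)
  then show ?case by (auto simp: order.order_iff_strict)
qed

lemma sorted_concat_replicate:
  "sorted (concat (map (\<lambda>i. replicate (f i) i) [m..<n]))"
  by (induction n) (auto simp: sorted_append)

lemma mset_rotate: "mset (rotate k w) = mset w"
proof -
  let ?m = "k mod length w"
  have "mset (rotate k w) = mset (take ?m w) + mset (drop ?m w)"
    by (simp add: rotate_drop_take)
  also have "\<dots> = mset (take ?m w @ drop ?m w)" by (simp only: mset_append)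
  finally show ?thesis by (simp only: append_take_drop_id)
qed

lemma count_concat_replicate:
  assumes "inj p"
  shows "count_list (concat (map (\<lambda>i. replicate (f (p i)) (p i)) [m..<n])) a
    = (if a \<in> p ` {m..<n} then f a else 0)"
proof (induction n)
  case (Suc n)
  then show ?case
    using inj_image_mem_iff[OF assms, of n "{m..<n}"]
    by (auto simp: atLeastLessThanSuc simp flip: count_mset)
qed simp

text \<open>
  Both sides of the defining equation of clustering are rearrangements of \<open>w\<close>, and the right-hand
  side is sorted with respect to the injective key \<open>inv \<pi>\<close>; so equality says that the
  Burrows-Wheeler transform is sorted with respect to this key.
\<close>

lemma clustering_iff_mono_last:
  fixes w :: "nat list"
  assumes set: "set w = {1..r}" and perm: "\<pi> permutes {1..r}"
  shows "clustering r \<pi> w \<longleftrightarrow>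
    (\<forall>c\<in>set (conjugates w). \<forall>d\<in>set (conjugates w).
       c < d \<longrightarrow> inv \<pi> (last c) \<le> inv \<pi> (last d))"
proof -
  define B where "B = burrows_wheeler w"
  define R where "R = concat (map (\<lambda>i. replicate (count_list w (\<pi> i)) (\<pi> i)) [1..<Suc r])"
  have inj: "inj \<pi>" "inj (inv \<pi>)"
    using permutes_inj[OF perm] permutes_inj[OF permutes_inv[OF perm]] by auto
  have "mset B = mset (map last (conjugates w))"
    unfolding B_def burrows_wheeler_def by simp
  then have B: "mset B = mset w"
    by (simp only: map_last_conjugates mset_rotate)
  have "\<pi> ` {1..<Suc r} = {1..r}"
    using permutes_image[OF perm] by (simp add: atLeastLessThanSuc_atLeastAtMost)
  then have R: "mset R = mset w"
    unfolding R_def using set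
    by (intro multiset_eqI)
      (simp add: count_mset count_concat_replicate[OF inj(1)] count_list_0_iff
        del: upt_Suc)
  have "map (inv \<pi>) R = concat (map (\<lambda>i. replicate (count_list w (\<pi> i)) i) [1..<Suc r])"
    unfolding R_def using inj(1) by (simp add: map_concat comp_def)
  then have sR: "sorted (map (inv \<pi>) R)"
    by (simp only: sorted_concat_replicate)
  have "B = R \<longleftrightarrow> sorted (map (inv \<pi>) B)"
  proof
    assume "sorted (map (inv \<pi>) B)"
    then have "map (inv \<pi>) B = map (inv \<pi>) R"
      using sR B R by (metis mset_map properties_for_sort)
    then show "B = R" using inj(2) by (simp add: inj_map_eq_map)
  qed (use sR in simp)
  also have "\<dots> \<longleftrightarrow> (\<forall>c\<in>set (conjugates w). \<forall>d\<in>set (conjugates w).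
       c < d \<longrightarrow> inv \<pi> (last c) \<le> inv \<pi> (last d))"
    unfolding B_def burrows_wheeler_def map_map
    by (subst sorted_map_iff_mono) auto
  finally show ?thesis unfolding clustering_def B_def R_def .
qed

section \<open>Interval exchange maps\<close>

lemma partial_sums_mono:
  fixes a :: "nat \<Rightarrow> 'a::linordered_ab_group_add"
  assumes "\<forall>k\<in>{1..r}. 0 \<le> a k" "i < j" "j \<le> r"
  shows "(\<Sum>k\<in>{1..i}. a k) \<le> (\<Sum>k\<in>{1..<j}. a k)"
  using assms by (intro sum_mono2) auto

lemma sum_upto_last:
  fixes a :: "nat \<Rightarrow> 'a::ab_group_add"
  assumes "1 \<le> i"
  shows "(\<Sum>k\<in>{1..i}. a k) = (\<Sum>k\<in>{1..<i}. a k) + a i"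
proof -
  have "{1..i} = insert i {1..<i}" using assms by auto
  then show ?thesis by (simp add: add.commute)
qed

lemma discrete_interval_less:
  assumes "length_vector r l" "i < j" "j \<le> r" "x \<in> discrete_interval l i" "y \<in> discrete_interval l j"
  shows "x < y"
  using partial_sums_mono[of r l i j] assms unfolding length_vector_def discrete_interval_def
  by fastforce

lemma continuous_interval_less:
  assumes "probability_vector r \<alpha>" "i < j" "j \<le> r"
    "x \<in> continuous_interval \<alpha> i" "y \<in> continuous_interval \<alpha> j"
  shows "x < y"
  using partial_sums_mono[of r \<alpha> i j] assms
  unfolding probability_vector_def continuous_interval_def by fastforce

text \<open>
  The hypothesis on \<open>D\<close> makes the intervals disjoint, so that the definite description in
  \<open>iet_map\<close> picks the interval containing \<open>x\<close>.
\<close>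

lemma iet_map_eq:
  fixes x :: "'a::linordered_ab_group_add"
  assumes "\<And>i j x y. i < j \<Longrightarrow> j \<le> r \<Longrightarrow> x \<in> D i \<Longrightarrow> y \<in> D j \<Longrightarrow> x < y"
    and "i \<in> {1..r}" "x \<in> D i"
  shows "iet_map r \<pi> a D x = x + iet_shift r \<pi> a i"
proof -
  have "(THE i. i \<in> {1..r} \<and> x \<in> D i) = i"
    using assms by (intro the_equality) (auto, metis less_irrefl linorder_neqE_nat)
  then show ?thesis unfolding iet_map_def by simp
qed

lemma discrete_iet_eq:
  assumes "length_vector r l" "i \<in> {1..r}" "x \<in> discrete_interval l i"
  shows "discrete_iet r \<pi> l x = x + iet_shift r \<pi> l i"
  unfolding discrete_iet_def
  using assms by (intro iet_map_eq discrete_interval_less[OF assms(1)])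

lemma continuous_iet_eq:
  assumes "probability_vector r \<alpha>" "i \<in> {1..r}" "x \<in> continuous_interval \<alpha> i"
  shows "continuous_iet r \<pi> \<alpha> x = x + iet_shift r \<pi> \<alpha> i"
  unfolding continuous_iet_def
  using assms by (intro iet_map_eq continuous_interval_less[OF assms(1)])

text \<open>
  The image of the \<open>i\<close>-th interval starts at the total length of the intervals that precede \<open>i\<close>
  in the order given by \<open>inv \<pi>\<close>, so it ends before the image of any later interval in that order.
\<close>

lemma continuous_iet_image_less:
  assumes prob: "probability_vector r \<alpha>" and i: "i \<in> {1..r}" and j: "j \<in> {1..r}"
    and less: "inv \<pi> i < inv \<pi> j"
    and x: "x \<in> continuous_interval \<alpha> i" and y: "y \<in> continuous_interval \<alpha> j"
  shows "continuous_iet r \<pi> \<alpha> x < continuous_iet r \<pi> \<alpha> y"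
proof -
  let ?before = "\<lambda>i. {k\<in>{1..r}. inv \<pi> k < inv \<pi> i}"
  have "continuous_iet r \<pi> \<alpha> x < sum \<alpha> (?before i) + \<alpha> i"
    using x sum_upto_last[of i \<alpha>] i
    by (simp add: continuous_iet_eq[OF prob i x] iet_shift_def continuous_interval_def)
  also have "\<dots> = sum \<alpha> (insert i (?before i))" by simp
  also have "\<dots> \<le> sum \<alpha> (?before j)"
    using less i prob by (intro sum_mono2) (auto simp: probability_vector_def)
  also have "\<dots> \<le> continuous_iet r \<pi> \<alpha> y"
    using y by (simp add: continuous_iet_eq[OF prob j y] iet_shift_def continuous_interval_def)
  finally show ?thesis .
qed

section \<open>Squares in trajectories are clustering\<close>

text \<open>
  At the first difference the intervals themselves decide the order. As long as
  the itineraries agree, both points are translated by the same amount, and the order is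
  carried back unchanged to the starting points.
\<close>

lemma itinerary_less_imp_point_less:
  assumes prob: "probability_vector r \<alpha>"
    and tr: "\<And>m. y m \<in> {1..r} \<and> z m \<in> continuous_interval \<alpha> (y m)"
    and step: "\<And>m. z (Suc m) = continuous_iet r \<pi> \<alpha> (z m)"
    and "\<forall>t<k. y (i + t) = y (j + t)" "y (i + k) < y (j + k)"
  shows "z i < z j"
  using assms(4,5)
proof (induction k arbitrary: i j)
  case 0
  then show ?case
    using continuous_interval_less[OF prob, of "y i" "y j"] tr by auto
next
  case (Suc k)
  have "z (Suc i) < z (Suc j)"
    using Suc.prems by (intro Suc.IH) (auto simp flip: add_Suc_right)
  moreover have "y i = y j" using Suc.prems(1)[rule_format, of 0] by simp
  ultimately show ?case
    using continuous_iet_eq[OF prob, of "y i" "z i" \<pi>] continuous_iet_eq[OF prob, of "y j" "z j" \<pi>]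
      tr[of i] tr[of j] by (simp add: step)
qed

text \<open>
  Conjugates \<open>c < d\<close> are initial parts of the itineraries of orbit points \<open>z i < z j\<close>. The points \<open>z (i - 1)\<close> and
  \<open>z (j - 1)\<close> lie in the intervals named by the last letters of \<open>c\<close> and \<open>d\<close>; last
  letters in the wrong order would put the images \<open>z i\<close> and \<open>z j\<close> in the wrong order.
\<close>

lemma continuous_occurrence_imp_clustering:
  fixes w :: "nat list"
  assumes set: "set w = {1..r}" and perm: "\<pi> permutes {1..r}"
    and prob: "probability_vector r \<alpha>"
    and occ: "occurs_in_continuous_iet r \<pi> \<alpha> (w @ w)"
  shows "clustering r \<pi> w"
proof -
  let ?n = "length w" and ?T = "continuous_iet r \<pi> \<alpha>"
  obtain x y0 p where tr0: "is_trajectory r (continuous_interval \<alpha>) ?T x y0"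
    and p: "w @ w = map y0 [p..<p + length (w @ w)]"
    using occ unfolding occurs_in_continuous_iet_def occurs_in_def by blast
  \<comment> \<open>Time starts anew at the occurrence of the square.\<close>
  define y where "y m = y0 (p + m)" for m
  define z where "z m = (?T ^^ (p + m)) x" for m
  have tr: "y m \<in> {1..r} \<and> z m \<in> continuous_interval \<alpha> (y m)" for m
    using tr0 unfolding is_trajectory_def y_def z_def by blast
  have step: "z (Suc m) = ?T (z m)" for m unfolding z_def by simp
  have y: "y m = w ! (m mod ?n)" if "m < 2 * ?n" for m
  proof -
    have "y m = (w @ w) ! m"
      using that by (subst p) (simp add: y_def)
    also have "\<dots> = w ! (m mod ?n)"
      using that by (auto simp: nth_append mod_if)
    finally show ?thesis .
  qed
  have "inv \<pi> (last c) \<le> inv \<pi> (last d)"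
    if c: "c \<in> set (conjugates w)" and d: "d \<in> set (conjugates w)" and less: "c < d" for c d
  proof (rule ccontr)
    assume "\<not> inv \<pi> (last c) \<le> inv \<pi> (last d)"
    then have gt: "inv \<pi> (last d) < inv \<pi> (last c)" by simp
    obtain i where i: "1 \<le> i" "i \<le> ?n" "c = rotate i w"
      using conjugate_as_positive_rotation[OF c] .
    obtain j where j: "1 \<le> j" "j \<le> ?n" "d = rotate j w"
      using conjugate_as_positive_rotation[OF d] .
    have ne: "w \<noteq> []" using i by auto
    have nth: "rotate s w ! t = y (s + t)" if "s \<le> ?n" "t < ?n" for s t
      using that y[of "s + t"] by (simp add: nth_rotate)
    have last: "last (rotate s w) = y (s - 1)" if "1 \<le> s" "s \<le> ?n" for s
    proof -
      have "s + (?n - 1) = (s - 1) + ?n" using that by simp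
      then have "(s + (?n - 1)) mod ?n = (s - 1) mod ?n" by simp
      then show ?thesis using that y[of "s - 1"] last_rotate[OF ne, of s] by simp
    qed
    obtain k where k: "k < ?n" "\<forall>t<k. c ! t = d ! t" "c ! k < d ! k"
      using less less_same_length_iff[of c d] i j by auto
    have "z i < z j"
      using k i j itinerary_less_imp_point_less[of r \<alpha> y z \<pi>, OF prob tr step, of k i j]
      by (auto simp: nth)
    moreover have "?T (z (j - 1)) < ?T (z (i - 1))"
      using gt tr i j last[of i] last[of j]
      by (intro continuous_iet_image_less[OF prob, of "y (j - 1)" "y (i - 1)"]) auto
    ultimately show False using step[of "i - 1"] step[of "j - 1"] i j by simp
  qed
  then show ?thesis using clustering_iff_mono_last[OF set perm] by blast
qed

section \<open>From discrete to continuous interval exchanges\<close>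

text \<open>
  The affine map taking the points \<open>1, ..., N\<close> to \<open>0, 1/N, ..., (N - 1)/N\<close> sends each
  discrete interval into the corresponding half-open real interval, and conjugates the two
  exchanges on these points.
\<close>

lemma discrete_occurrence_imp_continuous:
  assumes len: "length_vector r l" and occ: "occurs_in_discrete_iet r \<pi> l v"
  shows "\<exists>\<alpha>. probability_vector r \<alpha> \<and> occurs_in_continuous_iet r \<pi> \<alpha> v"
proof -
  define N where "N = (\<Sum>j\<in>{1..r}. l j)"
  let ?T = "discrete_iet r \<pi> l"
  obtain x y where x: "x \<in> {1..N}" and tr: "is_trajectory r (discrete_interval l) ?T x y"
    and v: "occurs_in v y"
    using occ unfolding occurs_in_discrete_iet_def discrete_space_def N_def by blast
  define \<alpha> where "\<alpha> i = real_of_int (l i) / real_of_int N" for i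
  define \<phi> where "\<phi> k = real_of_int (k - 1) / real_of_int N" for k
  let ?S = "continuous_iet r \<pi> \<alpha>"
  have N: "0 < N" using x by simp
  have sum: "sum \<alpha> A = real_of_int (sum l A) / real_of_int N" for A
    unfolding \<alpha>_def by (simp add: sum_divide_distrib)
  have prob: "probability_vector r \<alpha>"
    unfolding probability_vector_def sum N_def[symmetric] using len N
    by (auto simp: \<alpha>_def length_vector_def)
  have mem: "\<phi> k \<in> continuous_interval \<alpha> i" if "k \<in> discrete_interval l i" for k i
    using that N unfolding continuous_interval_def discrete_interval_def sum \<phi>_def
    by (auto simp: divide_le_cancel divide_less_cancel simp del: of_int_sum of_int_diff)
  have shift: "iet_shift r \<pi> \<alpha> i = real_of_int (iet_shift r \<pi> l i) / real_of_int N" for i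
    unfolding iet_shift_def sum by (simp add: diff_divide_distrib)
  have comm: "?S (\<phi> k) = \<phi> (?T k)" if "i \<in> {1..r}" "k \<in> discrete_interval l i" for k i
  proof -
    have "?S (\<phi> k) = \<phi> k + iet_shift r \<pi> \<alpha> i"
      by (rule continuous_iet_eq[OF prob that(1) mem[OF that(2)]])
    also have "\<dots> = \<phi> (?T k)"
      by (simp add: discrete_iet_eq[OF len that] shift \<phi>_def diff_divide_distrib add_divide_distrib)
    finally show ?thesis .
  qed
  have "(?S ^^ m) (\<phi> x) = \<phi> ((?T ^^ m) x)" for m
  proof (induction m)
    case (Suc m)
    then show ?case using comm[of "y m" "(?T ^^ m) x"] tr by (simp add: is_trajectory_def)
  qed simp
  then have "is_trajectory r (continuous_interval \<alpha>) ?S (\<phi> x) y"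
    using tr mem by (simp add: is_trajectory_def)
  moreover have "\<phi> x \<in> {0..<1}" using x N by (simp add: \<phi>_def)
  ultimately show ?thesis
    using prob v unfolding occurs_in_continuous_iet_def by blast
qed

section \<open>The discrete interval exchange of a clustering word\<close>

definition letter_counts :: "nat list \<Rightarrow> nat \<Rightarrow> int" where
  "letter_counts w i = int (count_list w i)"

text \<open>
  The rank of a conjugate, counted from 1. Describing it as a cardinality rather than as an index in the
  sorted list reduces the translation lengths to counting conjugates by first or last letter.
\<close>

definition conjugate_point :: "nat list \<Rightarrow> nat list \<Rightarrow> int" where
  "conjugate_point w c = 1 + int (card {d \<in> set (conjugates w). d < c})"

lemma rotate1_conjugates_bij:
  assumes "w \<noteq> []"
  shows "bij_betw rotate1 (set (conjugates w)) (set (conjugates w))"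
proof -
  have "rotate1 ` set (conjugates w) \<subseteq> set (conjugates w)"
    using rotate_in_conjugates[OF assms, of "Suc _"] by (auto simp: set_conjugates)
  moreover have "inj_on rotate1 (set (conjugates w))"
    by (rule inj_on_subset[OF inj_rotate1 subset_UNIV])
  ultimately show ?thesis
    by (simp add: bij_betw_def endo_inj_surj)
qed

lemma card_conjugates_hd:
  assumes "primitive_word w"
  shows "card {d \<in> set (conjugates w). hd d = j} = count_list w j"
proof -
  have "{d \<in> set (conjugates w). hd d = j} = (\<lambda>i. rotate i w) ` {i. i < length w \<and> w ! i = j}"
    unfolding set_conjugates using hd_rotate_conv_nth[of w] by (fastforce simp: image_iff)
  moreover have "inj_on (\<lambda>i. rotate i w) {i. i < length w \<and> w ! i = j}"
    by (rule inj_on_subset[OF inj_on_rotate_primitive[OF assms]]) auto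
  ultimately have "card {d \<in> set (conjugates w). hd d = j} = card {i. i < length w \<and> w ! i = j}"
    by (simp add: card_image)
  also have "\<dots> = count_list w j"
    by (simp add: count_list_eq_length_filter length_filter_conv_card eq_commute)
  finally show ?thesis .
qed

lemma card_conjugates_last:
  assumes "primitive_word w" "w \<noteq> []"
  shows "card {d \<in> set (conjugates w). last d = j} = count_list w j"
proof -
  let ?S = "set (conjugates w)"
  have bij: "rotate1 ` ?S = ?S" "inj_on rotate1 ?S"
    using rotate1_conjugates_bij[OF assms(2)] by (auto simp: bij_betw_def)
  have ne: "c \<noteq> []" if "c \<in> ?S" for c using that assms(2) length_conjugate by fastforce
  have "{d \<in> ?S. last d = j} = {d \<in> rotate1 ` ?S. last d = j}" by (simp only: bij(1))
  also have "\<dots> = rotate1 ` {d \<in> ?S. hd d = j}"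
    using ne last_rotate1 by fastforce
  finally have "{d \<in> ?S. last d = j} = rotate1 ` {d \<in> ?S. hd d = j}" .
  moreover have "inj_on rotate1 {d \<in> ?S. hd d = j}" by (rule inj_on_subset[OF bij(2)]) auto
  ultimately show ?thesis
    using card_conjugates_hd[OF assms(1)] by (simp add: card_image)
qed

lemma card_fibres:
  assumes "finite S" "finite J"
  shows "card {d \<in> S. f d \<in> J} = (\<Sum>j\<in>J. card {d \<in> S. f d = j})"
proof -
  have "{d \<in> S. f d \<in> J} = (\<Union>j\<in>J. {d \<in> S. f d = j})" by auto
  then show ?thesis using assms by (simp add: card_UN_disjoint disjoint_iff)
qed

lemma hd_conjugate_in_alphabet:
  assumes "set w = {1..r}" "c \<in> set (conjugates w)" shows "hd c \<in> {1..r}"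
proof -
  have "c \<noteq> []" using assms(2) by (auto simp: set_conjugates)
  then have "hd c \<in> set c" by simp
  then show ?thesis using set_conjugate[OF assms(2)] assms(1) by simp
qed

text \<open>
  A conjugate below \<open>c\<close> starts with a smaller letter, or with the same letter. The count of
  the latter is the offset of \<open>c\<close> in its interval; it reappears unchanged in
  \<open>conjugate_point_rotate1\<close>, and the difference of the two formulas is the translation length.
\<close>

lemma conjugate_point_hd:
  assumes prim: "primitive_word w" and set: "set w = {1..r}" and c: "c \<in> set (conjugates w)"
  shows "conjugate_point w c = 1 + (\<Sum>j\<in>{1..<hd c}. letter_counts w j)
    + int (card {d \<in> set (conjugates w). hd d = hd c \<and> d < c})"
proof -
  let ?S = "set (conjugates w)"
  have ne: "d \<noteq> []" if "d \<in> ?S" for d using that by (auto simp: set_conjugates)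
  have cons: "d < c \<longleftrightarrow> hd d < hd c \<or> hd d = hd c \<and> d < c" if "d \<in> ?S" for d
    using ne[OF that] ne[OF c] by (cases d; cases c) auto
  have "{d \<in> ?S. d < c} = {d \<in> ?S. hd d \<in> {1..<hd c}} \<union> {d \<in> ?S. hd d = hd c \<and> d < c}"
    using cons hd_conjugate_in_alphabet[OF set] by fastforce
  moreover have "{d \<in> ?S. hd d \<in> {1..<hd c}} \<inter> {d \<in> ?S. hd d = hd c \<and> d < c} = {}" by auto
  ultimately have "card {d \<in> ?S. d < c}
    = card {d \<in> ?S. hd d \<in> {1..<hd c}} + card {d \<in> ?S. hd d = hd c \<and> d < c}"
    by (simp add: card_Un_disjoint)
  moreover have "card {d \<in> ?S. hd d \<in> {1..<hd c}} = (\<Sum>j\<in>{1..<hd c}. count_list w j)"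
    by (subst card_fibres) (simp_all add: card_conjugates_hd[OF prim])
  ultimately show ?thesis by (simp add: conjugate_point_def letter_counts_def)
qed

text \<open>
  By clustering, the conjugates below \<open>rotate1 c\<close> are those ending with a letter that precedes
  \<open>hd c\<close> in the order given by \<open>inv \<pi>\<close>, and some of those ending with \<open>hd c\<close> itself. The latter are the images under \<open>rotate1\<close> of the conjugates
  below \<open>c\<close> with the same first letter, because \<open>rotate1\<close> is increasing on words with a common
  first letter.
\<close>

lemma conjugate_point_rotate1:
  assumes prim: "primitive_word w" and set: "set w = {1..r}" and perm: "\<pi> permutes {1..r}"
    and clus: "clustering r \<pi> w" and c: "c \<in> set (conjugates w)"
  shows "conjugate_point w (rotate1 c)
    = 1 + (\<Sum>j\<in>{j\<in>{1..r}. inv \<pi> j < inv \<pi> (hd c)}. letter_counts w j)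
    + int (card {d \<in> set (conjugates w). hd d = hd c \<and> d < c})"
proof -
  let ?S = "set (conjugates w)" and ?J = "{j\<in>{1..r}. inv \<pi> j < inv \<pi> (hd c)}"
  have w: "w \<noteq> []" using c by (auto simp: set_conjugates)
  have ne: "d \<noteq> []" if "d \<in> ?S" for d using that by (auto simp: set_conjugates)
  have bij: "rotate1 ` ?S = ?S" "inj_on rotate1 ?S"
    using rotate1_conjugates_bij[OF w] by (auto simp: bij_betw_def)
  have inj: "inj (inv \<pi>)" using permutes_inj[OF perm] permutes_inj[OF permutes_inv[OF perm]] by auto
  have mono: "inv \<pi> (last a) \<le> inv \<pi> (last b)" if "a \<in> ?S" "b \<in> ?S" "a < b" for a b
    using clus clustering_iff_mono_last[OF set perm] that by blast
  have rc: "rotate1 c \<in> ?S" "last (rotate1 c) = hd c"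
    using bij c ne[OF c] by (auto simp: last_rotate1)
  have lastin: "last d \<in> {1..r}" if "d \<in> ?S" for d
  proof -
    have "set d = {1..r}" using set_conjugate[OF that] set by simp
    then show ?thesis using last_in_set[OF ne[OF that]] by simp
  qed
  have split: "d < rotate1 c \<longleftrightarrow> last d \<in> ?J \<or> last d = hd c \<and> d < rotate1 c" if d: "d \<in> ?S" for d
  proof
    assume "d < rotate1 c"
    then show "last d \<in> ?J \<or> last d = hd c \<and> d < rotate1 c"
      using mono[OF d rc(1)] rc(2) lastin[OF d] inj
      by (auto simp: inj_eq order.order_iff_strict)
  next
    assume "last d \<in> ?J \<or> last d = hd c \<and> d < rotate1 c"
    moreover have "d < rotate1 c" if "last d \<in> ?J"
    proof (rule ccontr)
      assume "\<not> d < rotate1 c"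
      then have "rotate1 c < d \<or> d = rotate1 c" by auto
      then show False using mono[OF rc(1) d] rc(2) that by auto
    qed
    ultimately show "d < rotate1 c" by blast
  qed
  have "{d \<in> ?S. last d = hd c \<and> d < rotate1 c} = rotate1 ` {d \<in> ?S. hd d = hd c \<and> d < c}"
  proof -
    have "rotate1 d < rotate1 c \<longleftrightarrow> d < c" if "d \<in> ?S" "hd d = hd c" for d
      using rotate1_less[of d c] rotate1_less[of c d] that ne c length_conjugate
      by (metis less_asym linorder_neqE order_less_irrefl)
    then have "rotate1 ` {d \<in> ?S. hd d = hd c \<and> d < c}
      = {d \<in> rotate1 ` ?S. last d = hd c \<and> d < rotate1 c}"
      using ne last_rotate1 by fastforce
    then show ?thesis by (simp only: bij(1))
  qed
  moreover have "inj_on rotate1 {d \<in> ?S. hd d = hd c \<and> d < c}"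
    by (rule inj_on_subset[OF bij(2)]) auto
  ultimately have same: "card {d \<in> ?S. last d = hd c \<and> d < rotate1 c}
      = card {d \<in> ?S. hd d = hd c \<and> d < c}"
    by (simp add: card_image)
  have "{d \<in> ?S. d < rotate1 c}
      = {d \<in> ?S. last d \<in> ?J} \<union> {d \<in> ?S. last d = hd c \<and> d < rotate1 c}"
    using split by blast
  moreover have "{d \<in> ?S. last d \<in> ?J} \<inter> {d \<in> ?S. last d = hd c \<and> d < rotate1 c} = {}" by auto
  ultimately have "card {d \<in> ?S. d < rotate1 c}
    = card {d \<in> ?S. last d \<in> ?J} + card {d \<in> ?S. last d = hd c \<and> d < rotate1 c}"
    by (simp add: card_Un_disjoint)
  moreover have "card {d \<in> ?S. last d \<in> ?J} = (\<Sum>j\<in>?J. count_list w j)"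
    by (subst card_fibres) (simp_all add: card_conjugates_last[OF prim w])
  ultimately show ?thesis using same by (simp add: conjugate_point_def letter_counts_def)
qed

lemma conjugate_point_in_interval:
  assumes prim: "primitive_word w" and set: "set w = {1..r}" and c: "c \<in> set (conjugates w)"
  shows "conjugate_point w c \<in> discrete_interval (letter_counts w) (hd c)"
proof -
  let ?S = "set (conjugates w)"
  have "card {d \<in> ?S. hd d = hd c \<and> d < c} < card {d \<in> ?S. hd d = hd c}"
    using c by (intro psubset_card_mono) auto
  then have "int (card {d \<in> ?S. hd d = hd c \<and> d < c}) < letter_counts w (hd c)"
    by (simp add: card_conjugates_hd[OF prim] letter_counts_def)
  then show ?thesis
    using conjugate_point_hd[OF assms] hd_conjugate_in_alphabet[OF set c]
      sum_upto_last[of "hd c" "letter_counts w"]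
    by (simp add: discrete_interval_def)
qed

lemma discrete_iet_conjugate_point:
  assumes prim: "primitive_word w" and set: "set w = {1..r}" and perm: "\<pi> permutes {1..r}"
    and clus: "clustering r \<pi> w" and c: "c \<in> set (conjugates w)"
  shows "discrete_iet r \<pi> (letter_counts w) (conjugate_point w c) = conjugate_point w (rotate1 c)"
proof -
  have "length_vector r (letter_counts w)"
    by (simp add: length_vector_def letter_counts_def)
  then show ?thesis
    using discrete_iet_eq[of r "letter_counts w" "hd c" "conjugate_point w c" \<pi>]
      conjugate_point_in_interval[OF prim set c] hd_conjugate_in_alphabet[OF set c]
      conjugate_point_hd[OF prim set c] conjugate_point_rotate1[OF assms]
    by (simp add: iet_shift_def)
qed

lemma conjugate_point_image:
  assumes prim: "primitive_word w" and set: "set w = {1..r}"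
  shows "conjugate_point w ` set (conjugates w) = discrete_space r (letter_counts w)"
proof -
  let ?S = "set (conjugates w)"
  have card: "card ?S = length w"
    unfolding set_conjugates using inj_on_rotate_primitive[OF prim] by (simp add: card_image)
  have N: "(\<Sum>j\<in>{1..r}. letter_counts w j) = int (length w)"
    using sum_count_set[of w "{1..r}"] set by (simp add: letter_counts_def flip: of_nat_sum)
  have less: "conjugate_point w c < conjugate_point w d"
    if "c \<in> ?S" "d \<in> ?S" "c < d" for c d
    unfolding conjugate_point_def using that
    by (auto intro!: psubset_card_mono intro: order.strict_trans)
  have "inj_on (conjugate_point w) ?S"
    using less by (intro inj_onI) (metis linorder_neqE order_less_irrefl)
  moreover have "conjugate_point w c \<in> {1..int (length w)}" if "c \<in> ?S" for c
  proof -
    have "card {d \<in> ?S. d < c} < card ?S" using that by (intro psubset_card_mono) auto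
    then show ?thesis using card by (simp add: conjugate_point_def)
  qed
  ultimately have "conjugate_point w ` ?S = {1..int (length w)}"
    using card by (intro card_subset_eq) (auto simp: card_image)
  then show ?thesis by (simp only: discrete_space_def N)
qed

text \<open>
  The orbit of any point runs through all conjugates, so a nonempty set closed under the exchange is
  the whole space.
\<close>

lemma clustering_imp_minimal_discrete_occurrence:
  assumes prim: "primitive_word w" and set: "set w = {1..r}" and perm: "\<pi> permutes {1..r}"
    and clus: "clustering r \<pi> w" and w: "w \<noteq> []"
  shows "\<exists>l. length_vector r l \<and>
    minimal_map (discrete_topology (discrete_space r l)) (discrete_iet r \<pi> l) \<and>
    occurs_in_discrete_iet r \<pi> l (w @ w)"
proof -
  define l where "l = letter_counts w"
  let ?S = "set (conjugates w)" and ?T = "discrete_iet r \<pi> l" and ?X = "discrete_space r l"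
  let ?P = "conjugate_point w" and ?n = "length w"
  have image: "?P ` ?S = ?X" unfolding l_def by (rule conjugate_point_image[OF prim set])
  have orbit: "(?T ^^ m) (?P (rotate i w)) = ?P (rotate (m + i) w)" for m i
  proof (induction m)
    case (Suc m)
    then show ?case
      using discrete_iet_conjugate_point[OF prim set perm clus rotate_in_conjugates[OF w, of "m + i"]]
      by (simp add: l_def)
  qed simp
  have "minimal_map (discrete_topology ?X) ?T"
    unfolding minimal_map_def
  proof (intro allI impI, elim conjE)
    fix E assume "closedin (discrete_topology ?X) E" and "E \<noteq> {}"
      and inv: "{x \<in> topspace (discrete_topology ?X). ?T x \<in> E} = E"
    then obtain e where e: "e \<in> E" "e \<in> ?X" by auto
    have closed: "(?T ^^ m) e \<in> E" for m
      using e(1) inv by (induction m) auto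
    obtain i where i: "i < ?n" "e = ?P (rotate i w)"
      using e(2) image by (auto simp: set_conjugates)
    \<comment> \<open>From rotation \<open>i\<close>, go on to the full turn and then to rotation \<open>j\<close>.\<close>
    have "?P (rotate j w) \<in> E" if "j < ?n" for j
    proof -
      have "rotate (j + (?n - i) + i) w = rotate j w"
        using i that by (subst rotate_conv_mod) simp
      then show ?thesis using closed[of "j + (?n - i)"] orbit[of "j + (?n - i)" i] i by simp
    qed
    then have "?P ` ?S \<subseteq> E" by (auto simp: set_conjugates)
    then have "?X \<subseteq> E" using image by simp
    then show "E = topspace (discrete_topology ?X)" using inv by auto
  qed
  moreover have "occurs_in_discrete_iet r \<pi> l (w @ w)"
  proof -
    define y where "y m = hd (rotate m w)" for m
    have "is_trajectory r (discrete_interval l) ?T (?P w) y"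
      unfolding is_trajectory_def y_def
      using orbit[of _ 0] conjugate_point_in_interval[OF prim set rotate_in_conjugates[OF w]]
        hd_conjugate_in_alphabet[OF set rotate_in_conjugates[OF w]]
      by (simp add: l_def)
    moreover have "w @ w = map y [0..<0 + length (w @ w)]"
      using w by (intro nth_equalityI) (auto simp: y_def hd_rotate_conv_nth nth_append mod_if)
    then have "occurs_in (w @ w) y" unfolding occurs_in_def by blast
    moreover have "?P w \<in> ?X" using image rotate_in_conjugates[OF w, of 0] by auto
    ultimately show ?thesis unfolding occurs_in_discrete_iet_def by blast
  qed
  moreover have "length_vector r l" by (simp add: l_def length_vector_def letter_counts_def)
  ultimately show ?thesis by blast
qed

section \<open>The equivalence\<close>

theorem theorem1:
  fixes r :: nat and w :: "nat list" and \<pi> :: "nat \<Rightarrow> nat"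
  assumes "1 \<le> r"
    and "primitive_word w"
    and "set w = {1..r}"
    and "\<pi> permutes {1..r}" and "\<pi> \<noteq> id"
  shows "(clustering r \<pi> w \<longleftrightarrow>
      (\<exists>l. length_vector r l \<and>
        minimal_map (discrete_topology (discrete_space r l)) (discrete_iet r \<pi> l) \<and>
        occurs_in_discrete_iet r \<pi> l (w @ w)))
    \<and> (clustering r \<pi> w \<longleftrightarrow>
      (\<exists>l. length_vector r l \<and> occurs_in_discrete_iet r \<pi> l (w @ w)))
    \<and> (clustering r \<pi> w \<longleftrightarrow>
      (\<exists>\<alpha>. probability_vector r \<alpha> \<and> occurs_in_continuous_iet r \<pi> \<alpha> (w @ w)))"
proof -
  have "w \<noteq> []" using assms by auto
  then have "\<exists>l. length_vector r l \<and>
      minimal_map (discrete_topology (discrete_space r l)) (discrete_iet r \<pi> l) \<and>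
      occurs_in_discrete_iet r \<pi> l (w @ w)" if "clustering r \<pi> w"
    using clustering_imp_minimal_discrete_occurrence assms that by blast
  moreover have "\<exists>\<alpha>. probability_vector r \<alpha> \<and> occurs_in_continuous_iet r \<pi> \<alpha> (w @ w)"
    if "length_vector r l" "occurs_in_discrete_iet r \<pi> l (w @ w)" for l
    using discrete_occurrence_imp_continuous that by blast
  moreover have "clustering r \<pi> w"
    if "probability_vector r \<alpha>" "occurs_in_continuous_iet r \<pi> \<alpha> (w @ w)" for \<alpha>
    using continuous_occurrence_imp_clustering assms that by blast
  ultimately show ?thesis by blast
qed

end
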